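(* There exist $\alpha,\beta\in\mathbb{R}$ with $1,\alpha,\beta$ linearly independent over $\mathbb{Q}$, and an infinite $\alpha\beta$-orbit $(t_n)_{n=1}^\infty$, such that there exist sets $J\subseteq\mathbb{N}$ of arbitrarily small lower density satisfying $\dim_B\{t_n\mid n\in\mathbb{N}\setminus J\}=0$; that is, for every $\epsilon>0$ there is $J\subseteq\mathbb{N}$ with $\underline{d}(J)<\epsilon$ and $\dim_B\{t_n\mid n\in\mathbb{N}\setminus J\}=0$.
   Context: An (infinite) $\alpha\beta$-orbit is a sequence $(t_n)_{n=1}^\infty\subseteq\mathbb{R}/\mathbb{Z}$ with $t_{n+1}-t_n\in\{\alpha,\beta\}$ (mod $1$) for all $n$. For $J\subseteq\mathbb{N}$ the lower density is $\underline{d}(J)=\liminf_{N\to\infty}\frac1N|J\cap\{1,\ldots,N\}|$. For a set $E$, let $N(E,\rho)$ be the minimal number of intervals of length $\rho$ needed to cover $E$; the box dimension is $\dim_B E=\lim_{\rho\searrow 0}\frac{\log N(E,\rho)}{\log(1/\rho)}$ when the limit exists (so $\dim_B E=0$ means that the limit exists and equals $0$). *)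

theory Defs
  imports "HOL-Analysis.Analysis"
begin

quotient_type circle = real / "\<lambda>x y :: real. x - y \<in> \<int>"
  morphisms rep_circle circle_of_real
proof (rule equivpI)
  show "reflp (\<lambda>x y :: real. x - y \<in> \<int>)"
    by (simp add: reflp_def)
  show "symp (\<lambda>x y :: real. x - y \<in> \<int>)"
    by (metis (mono_tags, lifting) Ints_minus minus_diff_eq sympI)
  show "transp (\<lambda>x y :: real. x - y \<in> \<int>)"
    by (smt (verit, best) Ints_add transpI)
qed

instantiation circle :: ab_group_add
begin

lift_definition zero_circle :: circle is 0 .

lift_definition plus_circle :: "circle \<Rightarrow> circle \<Rightarrow> circle" is "(+)"
  by (metis Ints_add add_diff_add)

lift_definition uminus_circle :: "circle \<Rightarrow> circle" is uminus
  by (metis Ints_minus minus_diff_minus)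

lift_definition minus_circle :: "circle \<Rightarrow> circle \<Rightarrow> circle" is "(-)"
  by (metis (no_types, opaque_lifting) Ints_diff diff_diff_eq diff_diff_eq2 add.commute add_diff_eq)

instance
  by standard (transfer; simp)+

end

lemma circle_of_real_eq_iff: "circle_of_real x = circle_of_real y \<longleftrightarrow> x - y \<in> \<int>"
  by (fact circle.abs_eq_iff)

lemma circle_of_real_diff: "circle_of_real x - circle_of_real y = circle_of_real (x - y)"
  by (fact minus_circle.abs_eq)

text \<open>
  Linear independence of \<open>1, \<alpha>, \<beta>\<close> as a family. The library predicate
  speaks about the set \<open>{1, \<alpha>, \<beta>}\<close> only, so distinctness has to be required as well.
\<close>

definition rat_lin_indep_with_1 :: "real \<Rightarrow> real \<Rightarrow> bool" where
  "rat_lin_indep_with_1 \<alpha> \<beta> \<longleftrightarrow>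
     distinct [1, \<alpha>, \<beta>] \<and>
     module.independent (\<lambda>(q::rat) (x::real). of_rat q * x) {1, \<alpha>, \<beta>}"

lemma rat_lin_indep_with_1_iff:
  "rat_lin_indep_with_1 \<alpha> \<beta> \<longleftrightarrow>
     (\<forall>p q r :: rat. of_rat p + of_rat q * \<alpha> + of_rat r * \<beta> = 0 \<longrightarrow> p = 0 \<and> q = 0 \<and> r = 0)"
  (is "?L \<longleftrightarrow> ?R")
proof -
  interpret V: module "\<lambda>(q::rat) (x::real). of_rat q * x"
    by unfold_locales (auto simp: algebra_simps of_rat_add of_rat_mult)
  show ?thesis
  proof
    assume L: ?L
    show ?R
    proof (intro allI impI)
      fix p q r :: rat
      assume eq: "of_rat p + of_rat q * \<alpha> + of_rat r * \<beta> = 0"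
      define u where "u = (\<lambda>x. if x = 1 then p else if x = \<alpha> then q else r)"
      have "(\<Sum>x\<in>{1, \<alpha>, \<beta>}. of_rat (u x) * x) = 0"
        using L eq by (auto simp: rat_lin_indep_with_1_def u_def)
      then have "\<forall>x\<in>{1, \<alpha>, \<beta>}. u x = 0"
        using L by (auto simp: rat_lin_indep_with_1_def V.dependent_finite)
      then show "p = 0 \<and> q = 0 \<and> r = 0"
        using L by (auto simp: rat_lin_indep_with_1_def u_def split: if_splits)
    qed
  next
    assume R: ?R
    have d: "distinct [1, \<alpha>, \<beta>]"
      using R[rule_format, of 1 "-1" 0] R[rule_format, of 1 0 "-1"] R[rule_format, of 0 1 "-1"]
      by auto
    have "\<forall>x\<in>{1, \<alpha>, \<beta>}. u x = 0"
      if "(\<Sum>x\<in>{1, \<alpha>, \<beta>}. of_rat (u x) * x) = 0" for u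
      using that d R[rule_format, of "u 1" "u \<alpha>" "u \<beta>"] by (auto simp: algebra_simps)
    with d show ?L
      by (auto simp: rat_lin_indep_with_1_def V.dependent_finite)
  qed
qed

text \<open>Sequences are indexed from 1 and the value \<open>t 0\<close> plays no role.\<close>

definition alpha_beta_orbit :: "real \<Rightarrow> real \<Rightarrow> (nat \<Rightarrow> circle) \<Rightarrow> bool" where
  "alpha_beta_orbit \<alpha> \<beta> t \<longleftrightarrow>
     (\<forall>n\<ge>1. t (n + 1) - t n \<in> {circle_of_real \<alpha>, circle_of_real \<beta>})"

definition lower_density :: "nat set \<Rightarrow> ereal" where
  "lower_density J = liminf (\<lambda>N. ereal (real (card (J \<inter> {1..N})) / real N))"

text \<open>
  Closed arcs; open or half-open arcs would change covering numbers by at most a factor of 2.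
\<close>

definition is_interval_of_length :: "real \<Rightarrow> circle set \<Rightarrow> bool" where
  "is_interval_of_length \<rho> I \<longleftrightarrow> (\<exists>a. I = circle_of_real ` {a..a + \<rho>})"

definition covering_number :: "circle set \<Rightarrow> real \<Rightarrow> nat" where
  "covering_number E \<rho> =
     (LEAST k. \<exists>\<I>. finite \<I> \<and> card \<I> = k \<and> (\<forall>I\<in>\<I>. is_interval_of_length \<rho> I) \<and> E \<subseteq> \<Union>\<I>)"

lemma covering_number_attained:
  assumes "\<rho> > 0"
  shows "\<exists>\<I>. finite \<I> \<and> card \<I> = covering_number E \<rho> \<and>
               (\<forall>I\<in>\<I>. is_interval_of_length \<rho> I) \<and> E \<subseteq> \<Union>\<I>"
proof -
  define \<I> where "\<I> = (\<lambda>k::nat. circle_of_real ` {real k * \<rho>..real k * \<rho> + \<rho>}) ` {..nat \<lceil>1 / \<rho>\<rceil>}"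
  have "z \<in> \<Union>\<I>" for z
  proof -
    obtain x where z: "z = circle_of_real x"
      by (metis Quotient3_abs_rep Quotient3_circle)
    define k where "k = nat \<lfloor>frac x / \<rho>\<rfloor>"
    have z': "z = circle_of_real (frac x)"
      unfolding z circle_of_real_eq_iff by (simp add: frac_def)
    have k: "real k = of_int \<lfloor>frac x / \<rho>\<rfloor>"
      using assms by (simp add: k_def)
    have "frac x / \<rho> \<le> 1 / \<rho>"
      using assms frac_lt_1[of x] by (simp add: divide_right_mono)
    then have "\<lfloor>frac x / \<rho>\<rfloor> \<le> \<lceil>1 / \<rho>\<rceil>"
      by linarith
    then have "k \<le> nat \<lceil>1 / \<rho>\<rceil>"
      by (simp add: k_def nat_mono)
    moreover have "real k \<le> frac x / \<rho>" "frac x / \<rho> \<le> real k + 1"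
      unfolding k by linarith+
    then have "frac x \<in> {real k * \<rho>..real k * \<rho> + \<rho>}"
      using assms by (auto simp: field_simps)
    ultimately show ?thesis
      unfolding \<I>_def z' by blast
  qed
  then have "\<exists>k \<I>. finite \<I> \<and> card \<I> = k \<and> (\<forall>I\<in>\<I>. is_interval_of_length \<rho> I) \<and> E \<subseteq> \<Union>\<I>"
    by (intro exI[of _ "card \<I>"] exI[of _ \<I>]) (auto simp: \<I>_def is_interval_of_length_def)
  then show ?thesis
    unfolding covering_number_def by (rule LeastI_ex)
qed

definition has_box_dim :: "circle set \<Rightarrow> real \<Rightarrow> bool" where
  "has_box_dim E d \<longleftrightarrow>
     ((\<lambda>\<rho>. ln (real (covering_number E \<rho>)) / ln (1 / \<rho>)) \<longlongrightarrow> d) (at_right 0)"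

end

theory Submission
  imports Defs
begin

text \<open>
  Let \<open>C\<^sub>0\<close> be the word consisting of one letter \<open>\<beta>\<close>, and let \<open>C\<^sub>j\<^sub>+\<^sub>1\<close> be many copies
  of \<open>C\<^sub>j\<close> followed by a run of letters \<open>\<alpha>\<close> of negligible length. The orbit follows the
  limit of these words. The pair \<open>(\<alpha>, \<beta>)\<close> is the limit of rational points \<open>P\<^sub>j\<close> such that the
  displacement of \<open>C\<^sub>j\<close> is an integer at both \<open>P\<^sub>j\<close> and \<open>P\<^sub>j\<^sub>+\<^sub>1\<close>. If the run in \<open>C\<^sub>j\<^sub>+\<^sub>1\<close> is
  as long as the denominator of \<open>P\<^sub>j\<^sub>+\<^sub>1\<close>, then \<open>C\<^sub>j\<^sub>+\<^sub>1\<close> also has integral displacement at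
  \<open>P\<^sub>j\<^sub>+\<^sub>1\<close>, so the construction can continue. Choosing \<open>P\<^sub>j\<^sub>+\<^sub>2\<close> extremely close to \<open>P\<^sub>j\<^sub>+\<^sub>1\<close>
  makes the drift along all copies of \<open>C\<^sub>j\<close> in \<open>C\<^sub>j\<^sub>+\<^sub>1\<close> smaller than any prescribed negative
  power of the length of \<open>C\<^sub>j\<^sub>+\<^sub>1\<close>. After removal of the runs of \<open>\<alpha>\<close> from some level on, which
  is a set of small density, the orbit therefore stays within a large negative power of
  \<open>|C\<^sub>j\<^sub>+\<^sub>1|\<close> of a set of \<open>|C\<^sub>j|\<close> points, for every large \<open>j\<close>.
\<close>

subsection \<open>The frequencies\<close>

text \<open>
  The triple consists of the denominator \<open>q\<close> of \<open>P\<^sub>j\<close> and the numbers of letters \<open>\<alpha>\<close> and \<open>\<beta>\<close> in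
  \<open>C\<^sub>j\<close>. The factor \<open>2 ^ Suc j\<close> in \<open>m\<close> makes the runs of \<open>\<alpha>\<close> negligible, and the power of
  \<open>u + v\<close> makes the steps between the points \<open>P\<^sub>j\<close> small.
\<close>

primrec params :: "nat \<Rightarrow> nat \<times> nat \<times> nat" where
  "params 0 = (1, 0, 1)"
| "params (Suc j) = (case params j of (q, u, v) \<Rightarrow>
     let q' = 2 ^ (j + 4) * q * (u + v) ^ (j + 3); m = 2 ^ Suc j * q'
     in (q', m * u + q', m * v))"

definition den :: "nat \<Rightarrow> nat" where "den j = fst (params j)"
definition cnt_a :: "nat \<Rightarrow> nat" where "cnt_a j = fst (snd (params j))"
definition cnt_b :: "nat \<Rightarrow> nat" where "cnt_b j = snd (snd (params j))"
definition len :: "nat \<Rightarrow> nat" where "len j = cnt_a j + cnt_b j"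
definition reps :: "nat \<Rightarrow> nat" where "reps j = 2 ^ j * den j"

lemma params_0 [simp]: "den 0 = 1" "cnt_a 0 = 0" "cnt_b 0 = 1" "len 0 = 1"
  by (simp_all add: den_def cnt_a_def cnt_b_def len_def)

lemma den_Suc: "den (Suc j) = 2 ^ (j + 4) * den j * len j ^ (j + 3)"
  and cnt_a_Suc: "cnt_a (Suc j) = reps (Suc j) * cnt_a j + den (Suc j)"
  and cnt_b_Suc: "cnt_b (Suc j) = reps (Suc j) * cnt_b j"
  by (simp_all add: den_def cnt_a_def cnt_b_def len_def reps_def Let_def split: prod.split)

lemma len_Suc: "len (Suc j) = reps (Suc j) * len j + den (Suc j)"
  by (simp add: len_def cnt_a_Suc cnt_b_Suc algebra_simps)

lemma params_pos: "den j > 0 \<and> cnt_b j > 0"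
  by (induction j) (auto simp: den_Suc cnt_b_Suc reps_def len_def)

lemma den_pos [simp]: "den j > 0" and cnt_b_pos [simp]: "cnt_b j > 0"
  and len_pos [simp]: "len j > 0" and reps_pos [simp]: "reps j > 0"
  using params_pos[of j] by (auto simp: len_def reps_def)

lemma len_ge: "len (Suc j) \<ge> 2 ^ Suc j * len j" "len (Suc j) \<ge> len j"
proof -
  have d: "den (Suc j) \<ge> 1" and l: "len j \<ge> 1"
    by (simp_all add: Suc_leI)
  show "len (Suc j) \<ge> 2 ^ Suc j * len j" "len (Suc j) \<ge> len j"
    using mult_le_mono[OF d le_refl[of "2 ^ Suc j * len j"]] l
    by (auto simp: len_Suc reps_def intro!: trans_le_add1)
qed

lemma len_mono: "i \<le> j \<Longrightarrow> len i \<le> len j"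
  by (rule lift_Suc_mono_le[of len]) (auto intro: len_ge)

lemma len_ge_power2: "len j \<ge> 2 ^ j"
proof (cases j)
  case (Suc i)
  have "1 * 2 ^ Suc i \<le> len i * 2 ^ Suc i"
    by (intro mult_le_mono1) (simp add: Suc_leI)
  also have "\<dots> \<le> len (Suc i)"
    using len_ge(1)[of i] by (simp only: mult.commute)
  finally show ?thesis
    using Suc by simp
qed simp

lemma less_len: "j < len j"
  using len_ge_power2[of j] less_exp[of j] by linarith

text \<open>The l1 length of the jump from \<open>P\<^sub>j\<close> to
  \<open>P\<^sub>j\<^sub>+\<^sub>1\<close>, whose vector is
  \<open>(cnt_b j, - cnt_a j) / den (Suc j)\<close>.\<close>

definition step :: "nat \<Rightarrow> real" where "step j = len j / den (Suc j)"

lemma step_eq: "step j = 1 / (2 ^ (j + 4) * den j * len j ^ (j + 2))"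
  by (simp add: step_def den_Suc power_add eval_nat_numeral)

lemma step_nonneg: "step j \<ge> 0"
  by (simp add: step_def)

lemma den_mono: "den j \<le> den (Suc j)"
proof -
  have "1 * den j \<le> (2 ^ (j + 4) * len j ^ (j + 3)) * den j"
    by (intro mult_le_mono1) (simp add: Suc_leI del: power_add)
  then show ?thesis
    by (simp add: den_Suc mult_ac)
qed

lemma step_half: "step (Suc j) \<le> step j / 2"
proof -
  have "len j ^ (j + 2) \<le> len (Suc j) ^ (j + 2)"
    by (intro power_mono len_mono) auto
  also have "\<dots> \<le> len (Suc j) ^ (Suc j + 2)"
    by (intro power_increasing) (auto simp: Suc_leI)
  finally have "2 * 2 ^ (j + 4) * den j * len j ^ (j + 2)
      \<le> 2 ^ (Suc j + 4) * den (Suc j) * len (Suc j) ^ (Suc j + 2)"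
    using den_mono[of j] by (intro mult_le_mono) (auto simp: power_add)
  then have "real (2 * 2 ^ (j + 4) * den j * len j ^ (j + 2))
      \<le> real (2 ^ (Suc j + 4) * den (Suc j) * len (Suc j) ^ (Suc j + 2))"
    by (rule of_nat_mono)
  then have "1 / real (2 ^ (Suc j + 4) * den (Suc j) * len (Suc j) ^ (Suc j + 2))
      \<le> 1 / real (2 * 2 ^ (j + 4) * den j * len j ^ (j + 2))"
    by (intro divide_left_mono) auto
  then show ?thesis
    unfolding step_eq by (simp add: mult.assoc)
qed

section \<open>Convergence of the approximating points and integrality of block
  displacements\<close>

lemma geometric_tail:
  fixes a c :: "nat \<Rightarrow> real"
  assumes a: "\<And>i. \<bar>a i\<bar> \<le> c i" and c: "\<And>i. c (Suc i) \<le> c i / 2"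
  shows "summable a" and "\<bar>suminf a - (\<Sum>i<j. a i)\<bar> \<le> 2 * c j"
proof -
  have le: "c (i + j) \<le> c j * (1 / 2) ^ i" for i j
  proof (induction i)
    case (Suc i)
    then show ?case
      using c[of "i + j"] by simp
  qed simp
  have sums: "(\<lambda>i. c j * (1 / 2) ^ i) sums (2 * c j)" for j
    using sums_mult[OF geometric_sums[of "1 / 2 :: real"], of "c j"] by (simp add: mult.commute)
  have bound: "norm (a (i + j)) \<le> c j * (1 / 2) ^ i" for i j
    using a[of "i + j"] le[of i j] by simp
  show s: "summable a"
    using summable_comparison_test'[OF sums_summable[OF sums[of 0]], of 0 a] bound[of _ 0] by simp
  have "norm (\<Sum>i. a (i + j)) \<le> (\<Sum>i. c j * (1 / 2) ^ i)"
    using bound[of _ j] by (intro norm_suminf_le sums_summable[OF sums])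
  also have "\<dots> = 2 * c j"
    using sums by (simp add: sums_iff)
  finally show "\<bar>suminf a - (\<Sum>i<j. a i)\<bar> \<le> 2 * c j"
    using suminf_minus_initial_segment[OF s, of j] by simp
qed

definition alpha_approx :: "nat \<Rightarrow> real" where
  "alpha_approx j = (\<Sum>i<j. cnt_b i / den (Suc i))"
definition beta_approx :: "nat \<Rightarrow> real" where
  "beta_approx j = (\<Sum>i<j. - (cnt_a i / den (Suc i)))"
definition alpha :: real where "alpha = (\<Sum>i. cnt_b i / den (Suc i))"
definition beta :: real where "beta = (\<Sum>i. - (cnt_a i / den (Suc i)))"

lemma alpha_error: "\<bar>alpha - alpha_approx j\<bar> \<le> 2 * step j"
  unfolding alpha_def alpha_approx_def
  by (intro geometric_tail step_half) (simp add: step_def len_def divide_right_mono)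

lemma beta_error: "\<bar>beta - beta_approx j\<bar> \<le> 2 * step j"
  unfolding beta_def beta_approx_def
  by (intro geometric_tail step_half) (simp add: step_def len_def divide_right_mono)

text \<open>Each denominator divides the next, and the increment leading to index
  \<open>Suc j\<close> is an integer over \<open>den (Suc j)\<close>.\<close>

lemma den_approx_Ints: "den j * alpha_approx j \<in> \<int> \<and> den j * beta_approx j \<in> \<int>"
proof (induction j)
  case (Suc j)
  have *: "real (den (Suc j)) = of_nat (2 ^ (j + 4) * len j ^ (j + 3)) * den j"
    by (simp add: den_Suc)
  have "den (Suc j) * alpha_approx (Suc j) =
      of_nat (2 ^ (j + 4) * len j ^ (j + 3)) * (den j * alpha_approx j) + of_nat (cnt_b j)"
    by (simp add: alpha_approx_def algebra_simps flip: *) (simp add: den_Suc)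
  moreover have "den (Suc j) * beta_approx (Suc j) =
      of_nat (2 ^ (j + 4) * len j ^ (j + 3)) * (den j * beta_approx j) - of_nat (cnt_a j)"
    by (simp add: beta_approx_def algebra_simps flip: *) (simp add: den_Suc)
  ultimately show ?case
    using Suc by (auto intro!: Ints_add Ints_diff Ints_mult)
qed (simp add: alpha_approx_def beta_approx_def)

text \<open>The increment of the approximating point is orthogonal to \<open>(cnt_a j, cnt_b j)\<close>.\<close>

lemma approx_on_line:
  "cnt_a j * alpha_approx (Suc j) + cnt_b j * beta_approx (Suc j) =
   cnt_a j * alpha_approx j + cnt_b j * beta_approx j"
  by (simp add: alpha_approx_def beta_approx_def algebra_simps)

text \<open>Moving to \<open>P\<^sub>j\<^sub>+\<^sub>1\<close> leaves the displacement of each copy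
  of \<open>C\<^sub>j\<close> unchanged, hence integral, and the run of \<open>den (Suc j)\<close>
  letters \<alpha> contributes an integer because its length clears the denominator there.\<close>

lemma line_Ints: "cnt_a j * alpha_approx j + cnt_b j * beta_approx j \<in> \<int>"
proof (induction j)
  case (Suc j)
  have "cnt_a (Suc j) * alpha_approx (Suc j) + cnt_b (Suc j) * beta_approx (Suc j) =
      of_nat (reps (Suc j)) * (cnt_a j * alpha_approx j + cnt_b j * beta_approx j)
      + den (Suc j) * alpha_approx (Suc j)"
    unfolding approx_on_line[of j, symmetric] by (simp add: cnt_a_Suc cnt_b_Suc algebra_simps)
  then show ?case
    using Suc den_approx_Ints[of "Suc j"] by (auto intro!: Ints_add Ints_mult)
qed (simp add: alpha_approx_def beta_approx_def)

text \<open>The integer is the displacement at \<open>P\<^sub>j\<^sub>+\<^sub>1\<close> rather than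
  \<open>P\<^sub>j\<close>, so the error is governed by the far smaller
  \<open>step (Suc j)\<close>.\<close>

lemma block_drift:
  obtains z where "z \<in> \<int>"
    "\<bar>cnt_a j * alpha + cnt_b j * beta - z\<bar> \<le> 2 * len j * step (Suc j)"
proof
  define z where "z = cnt_a j * alpha_approx (Suc j) + cnt_b j * beta_approx (Suc j)"
  show "z \<in> \<int>"
    unfolding z_def approx_on_line by (rule line_Ints)
  have "cnt_a j * alpha + cnt_b j * beta - z =
      cnt_a j * (alpha - alpha_approx (Suc j)) + cnt_b j * (beta - beta_approx (Suc j))"
    by (simp add: z_def algebra_simps)
  also have "\<bar>\<dots>\<bar> \<le> cnt_a j * \<bar>alpha - alpha_approx (Suc j)\<bar> + cnt_b j * \<bar>beta - beta_approx (Suc j)\<bar>"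
    by (metis abs_triangle_ineq abs_mult abs_of_nat)
  also have "\<dots> \<le> cnt_a j * (2 * step (Suc j)) + cnt_b j * (2 * step (Suc j))"
    by (intro add_mono mult_left_mono alpha_error beta_error) auto
  finally show "\<bar>cnt_a j * alpha + cnt_b j * beta - z\<bar> \<le> 2 * len j * step (Suc j)"
    by (simp add: len_def algebra_simps)
qed

section \<open>Rational independence\<close>

text \<open>
  An integral relation evaluated at the \<open>j\<close>-th approximating point is a multiple of
  \<open>1 / den j\<close>, but too small to be a nonzero one. So all approximating points from some index on
  satisfy it, which the strictly increasing slopes \<open>cnt_a j / cnt_b j\<close> prevent.
\<close>

lemma no_integer_relation:
  fixes p q r :: int
  assumes eq: "p + q * alpha + r * beta = 0"
  shows "p = 0 \<and> q = 0 \<and> r = 0"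
proof -
  \<comment> \<open>From index \<open>k\<close> on the coefficients are below \<open>2 ^ j\<close>,
    which the factor \<open>2 ^ (j + 4)\<close> in \<open>den (Suc j)\<close> absorbs.\<close>
  obtain k :: nat where "real_of_int (\<bar>q\<bar> + \<bar>r\<bar>) < 2 ^ k"
    using real_arch_pow[of 2 "real_of_int (\<bar>q\<bar> + \<bar>r\<bar>)"] by auto
  then have k: "real_of_int (\<bar>q\<bar> + \<bar>r\<bar>) < 2 ^ j" if "j \<ge> k" for j
    using that by (meson less_le_trans one_le_numeral power_increasing)
  have zero: "p + q * alpha_approx j + r * beta_approx j = 0" if "j \<ge> k" for j
  proof -
    define R where "R = p + q * alpha_approx j + r * beta_approx j"
    have "den j * R = of_int (int (den j) * p) + of_int q * (den j * alpha_approx j)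
        + of_int r * (den j * beta_approx j)"
      by (simp add: R_def algebra_simps)
    then have "den j * R \<in> \<int>"
      using den_approx_Ints[of j] by (auto intro!: Ints_add Ints_mult)
    have "R = q * (alpha_approx j - alpha) + r * (beta_approx j - beta)"
      using eq by (simp add: R_def algebra_simps)
    also have "\<bar>\<dots>\<bar> \<le> \<bar>of_int q\<bar> * \<bar>alpha - alpha_approx j\<bar> + \<bar>of_int r\<bar> * \<bar>beta - beta_approx j\<bar>"
      by (metis abs_triangle_ineq abs_mult abs_minus_commute)
    also have "\<dots> \<le> \<bar>of_int q\<bar> * (2 * step j) + \<bar>of_int r\<bar> * (2 * step j)"
      by (intro add_mono mult_left_mono alpha_error beta_error) auto
    also have "\<dots> = of_int (\<bar>q\<bar> + \<bar>r\<bar>) * (2 * step j)"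
      by (simp add: algebra_simps)
    also have "\<dots> \<le> 2 ^ j * (2 * step j)"
      using k[OF that] by (intro mult_right_mono) (auto simp: step_nonneg)
    finally have "\<bar>den j * R\<bar> \<le> den j * (2 ^ j * (2 * step j))"
      by (simp add: abs_mult mult_left_mono)
    also have "\<dots> = 1 / (8 * real (len j) ^ (j + 2))"
      by (simp add: step_eq power_add field_simps)
    also have "\<dots> < 1"
      using one_le_power[of "real (len j)" "j + 2"] len_pos[of j] by (simp add: Suc_leI)
    finally have "den j * R = 0"
      using \<open>den j * R \<in> \<int>\<close> by (intro Ints_nonzero_abs_less1)
    then show ?thesis
      using den_pos[of j] by (simp add: R_def)
  qed
  have slope: "q * cnt_b j = r * cnt_a j" if "j \<ge> k" for j
  proof -
    have "0 = (p + q * alpha_approx (Suc j) + r * beta_approx (Suc j))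
        - (p + q * alpha_approx j + r * beta_approx j)"
      using zero[of j] zero[of "Suc j"] that by simp
    also have "\<dots> = (q * cnt_b j - r * cnt_a j) / real (den (Suc j))"
      by (simp add: alpha_approx_def beta_approx_def algebra_simps diff_divide_distrib)
    finally have "0 = (q * cnt_b j - r * cnt_a j) / real (den (Suc j))" .
    then have "real_of_int (q * cnt_b j) = real_of_int (r * cnt_a j)"
      using den_pos[of "Suc j"] by simp
    then show ?thesis
      by linarith
  qed
  \<comment> \<open>Comparing with \<open>reps (Suc k)\<close> times the relation at
    \<open>k\<close> leaves only \<open>r * den (Suc k) = 0\<close>.\<close>
  have "int (reps (Suc k)) * (q * cnt_b k) = int (reps (Suc k)) * (r * cnt_a k) + r * den (Suc k)"
    using slope[of "Suc k"] by (simp add: cnt_a_Suc cnt_b_Suc algebra_simps)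
  then have "r = 0"
    using slope[of k] den_pos[of "Suc k"] by simp
  moreover have "q = 0"
    using slope[of k] cnt_b_pos[of k] \<open>r = 0\<close> by simp
  ultimately show ?thesis
    using eq by simp
qed

lemma common_denominator:
  obtains d :: int where "d > 0" "\<exists>a. (p::rat) * of_int d = of_int a"
    "\<exists>a. (q::rat) * of_int d = of_int a" "\<exists>a. (r::rat) * of_int d = of_int a"
proof -
  obtain a b c d e f where *: "p = of_int a / of_int b" "b > 0" "q = of_int c / of_int d" "d > 0"
      "r = of_int e / of_int f" "f > 0"
    by (metis Fract_of_int_quotient Rat_cases)
  show ?thesis
  proof
    show "b * d * f > 0" using * by simp
    have "p * of_int (b * d * f) = of_int (a * d * f)" "q * of_int (b * d * f) = of_int (c * b * f)"
      "r * of_int (b * d * f) = of_int (e * b * d)"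
      using * by auto
    then show "\<exists>a. p * of_int (b * d * f) = of_int a" "\<exists>a. q * of_int (b * d * f) = of_int a"
      "\<exists>a. r * of_int (b * d * f) = of_int a"
      by blast+
  qed
qed

lemma rat_lin_indep_alpha_beta: "rat_lin_indep_with_1 alpha beta"
  unfolding rat_lin_indep_with_1_iff
proof (intro allI impI)
  fix p q r :: rat
  assume eq: "of_rat p + of_rat q * alpha + of_rat r * beta = 0"
  obtain d a b c where d: "d > 0" "p * of_int d = of_int a" "q * of_int d = of_int b"
      "r * of_int d = of_int c"
    by (metis common_denominator)
  have conv: "(of_rat x :: real) * of_int d = of_int y" if "x * of_int d = of_int y" for x y
    using arg_cong[OF that, of "of_rat :: rat \<Rightarrow> real"] by (simp add: of_rat_mult)
  have "of_int a + of_int b * alpha + of_int c * beta =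
      (of_rat p + of_rat q * alpha + of_rat r * beta) * of_int d"
    unfolding d(2-4)[THEN conv, symmetric] by (simp add: algebra_simps)
  then have "a = 0 \<and> b = 0 \<and> c = 0"
    using eq by (intro no_integer_relation) simp
  then show "p = 0 \<and> q = 0 \<and> r = 0"
    using d by auto
qed

subsection \<open>The orbit\<close>

text \<open>\<open>True\<close> stands for \<alpha> and \<open>False\<close> for \<beta>;
  \<open>letter j\<close> spells \<open>C\<^sub>j\<close> on the indices below
  \<open>len j\<close>.\<close>

primrec letter :: "nat \<Rightarrow> nat \<Rightarrow> bool" where
  "letter 0 n = False"
| "letter (Suc j) n = (n < reps (Suc j) * len j \<longrightarrow> letter j (n mod len j))"

text \<open>The diagonal reads off the limit word, since \<open>n < len n\<close> and each
  \<open>C\<^sub>j\<close> is a prefix of the next.\<close>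

definition word :: "nat \<Rightarrow> bool" where "word n = letter n n"

lemma reps_len_ge: "len j \<le> reps (Suc j) * len j"
  using reps_pos[of "Suc j"] by (simp del: reps_pos)

lemma reps_len_le: "reps (Suc j) * len j \<le> len (Suc j)"
  by (simp add: len_Suc)

lemma letter_stable: "j \<le> k \<Longrightarrow> n < len j \<Longrightarrow> letter k n = letter j n"
proof (induction k rule: dec_induct)
  case (step k)
  then have "n < len k"
    using len_mono[of j k] by simp
  then show ?case
    using step less_le_trans[OF _ reps_len_ge] by simp
qed simp

lemma word_eq_letter: "n < len j \<Longrightarrow> word n = letter j n"
  unfolding word_def using letter_stable[of j n n] letter_stable[of n j n] less_len[of n]
  by (metis nle_le)

lemma word_mod:
  assumes "n < reps (Suc j) * len j"
  shows "word n = word (n mod len j)"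
  using assms reps_len_le[of j] word_eq_letter[of n "Suc j"] word_eq_letter[of "n mod len j" j]
  by simp

definition position :: "nat \<Rightarrow> real" where
  "position n = (\<Sum>i<n. if word i then alpha else beta)"

lemma position_add: "position (m + n) = position m + (\<Sum>i<n. if word (m + i) then alpha else beta)"
  by (induction n) (auto simp: position_def)

lemma position_repeat:
  assumes "r \<le> len j" "i * len j + r \<le> reps (Suc j) * len j"
  shows "position (i * len j + r) = i * position (len j) + position r"
  using assms(2)
proof (induction i)
  case (Suc i)
  have "word (len j + l) = word l" if "l < i * len j + r" for l
    using word_mod[of "len j + l" j] word_mod[of l j] that Suc.prems by simp
  then have "position (len j + (i * len j + r)) = position (len j) + position (i * len j + r)"
    unfolding position_add[of "len j" "i * len j + r"] by (simp add: position_def)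
  then show ?case
    using Suc by (simp add: algebra_simps)
qed simp

lemma position_len: "position (len j) = cnt_a j * alpha + cnt_b j * beta"
proof (induction j)
  case 0
  then show ?case by (simp add: position_def word_def)
next
  case (Suc j)
  have "word (reps (Suc j) * len j + i)" if "i < den (Suc j)" for i
    using that word_eq_letter[of "reps (Suc j) * len j + i" "Suc j"] by (simp add: len_Suc)
  then have "position (len (Suc j)) = position (reps (Suc j) * len j) + den (Suc j) * alpha"
    unfolding len_Suc position_add by simp
  also have "position (reps (Suc j) * len j) = reps (Suc j) * position (len j)"
    using position_repeat[of 0 j "reps (Suc j)"] by (simp add: position_def)
  finally show ?case
    by (simp add: Suc cnt_a_Suc cnt_b_Suc algebra_simps)
qed

section \<open>Positions kept and their density\<close>

text \<open>Positions below \<open>len (k + i)\<close> outside the runs of \<open>alpha\<close> added at levels above \<open>k\<close>.\<close>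

primrec good :: "nat \<Rightarrow> nat \<Rightarrow> nat set" where
  "good k 0 = {..<len k}"
| "good k (Suc i) = {n. n < reps (Suc (k + i)) * len (k + i) \<and> n mod len (k + i) \<in> good k i}"

lemma good_subset: "good k i \<subseteq> {..<len (k + i)}"
proof (cases i)
  case (Suc l)
  then show ?thesis
    using reps_len_le[of "k + l"] by auto
qed simp

lemma good_mono: "i \<le> i' \<Longrightarrow> good k i \<subseteq> good k i'"
proof (rule lift_Suc_mono_le[of "good k"])
  fix i
  show "good k i \<subseteq> good k (Suc i)"
  proof
    fix n assume n: "n \<in> good k i"
    then have "n < len (k + i)"
      using good_subset by auto
    then show "n \<in> good k (Suc i)"
      using n less_le_trans[OF _ reps_len_ge] by simp
  qed
qed

lemma card_good_Suc: "card (good k (Suc i)) = reps (Suc (k + i)) * card (good k i)"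
proof -
  define L where "L = len (k + i)"
  have "L > 0"
    by (simp add: L_def)
  have L: "r < L" if "r \<in> good k i" for r
    using that good_subset[of k i] by (auto simp: L_def)
  have "bij_betw (\<lambda>(a, r). a * L + r) ({..<reps (Suc (k + i))} \<times> good k i) (good k (Suc i))"
  proof (rule bij_betw_byWitness[where f' = "\<lambda>n. (n div L, n mod L)"])
    show "(\<lambda>(a, r). a * L + r) ` ({..<reps (Suc (k + i))} \<times> good k i) \<subseteq> good k (Suc i)"
    proof clarify
      fix a r assume *: "a < reps (Suc (k + i))" "r \<in> good k i"
      have "a * L + r < Suc a * L"
        using L[OF *(2)] by simp
      also have "\<dots> \<le> reps (Suc (k + i)) * L"
        using *(1) by (intro mult_le_mono1) simp
      finally show "a * L + r \<in> good k (Suc i)"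
        using * L[OF *(2)] by (simp add: L_def)
    qed
    show "(\<lambda>n. (n div L, n mod L)) ` good k (Suc i) \<subseteq> {..<reps (Suc (k + i))} \<times> good k i"
      by (auto simp: L_def less_mult_imp_div_less)
  qed (use L \<open>L > 0\<close> in auto)
  then show ?thesis
    by (simp add: bij_betw_same_card[symmetric] card_cartesian_product)
qed

text \<open>Passing to the next level lowers the density by at most
  \<open>1 / 2 ^ Suc (k + i)\<close>, the ratio of \<open>den\<close> to \<open>reps\<close>. The
  term \<open>1 / 2 ^ (k + i)\<close> makes these losses telescope, starting from density 1 at
  \<open>i = 0\<close>.\<close>

lemma card_good: "real (card (good k i)) \<ge> (1 - 1 / 2 ^ k + 1 / 2 ^ (k + i)) * len (k + i)"
proof (induction i)
  case (Suc i)
  define m where "m = real (reps (Suc (k + i)))"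
  define L where "L = real (len (k + i))"
  define x where "x = (1 / 2 :: real) ^ Suc (k + i)"
  have L: "L \<ge> 1"
    by (simp add: L_def Suc_leI)
  have m: "real (den (Suc (k + i))) = m * x"
    by (simp add: m_def x_def reps_def field_simps)
  have len: "real (len (k + Suc i)) = m * L + m * x"
    by (simp add: len_Suc m) (simp add: m_def L_def)
  have m0: "m \<ge> 0"
    by (simp add: m_def)
  define c where "c = 1 - 1 / 2 ^ k + x"
  have c: "c \<le> 1"
    using power_increasing[of k "Suc (k + i)" "2::real"]
    by (auto simp: c_def x_def power_one_over intro!: divide_left_mono)
  have x0: "x \<ge> 0"
    by (simp add: x_def)
  have "(1 - 1 / 2 ^ k + 1 / 2 ^ (k + Suc i)) * len (k + Suc i) = c * (m * L + m * x)"
    unfolding len by (simp add: c_def x_def power_one_over)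
  also have "\<dots> = c * (m * L) + c * (m * x)"
    by (simp add: algebra_simps)
  also have "\<dots> \<le> c * (m * L) + 1 * (m * x)"
    using c m0 x0 L by (intro add_mono mult_right_mono) auto
  also have "\<dots> \<le> c * (m * L) + (m * x) * L"
    using L m0 x0 mult_left_mono[of 1 L "m * x"] by simp
  also have "\<dots> = m * ((1 - 1 / 2 ^ k + 1 / 2 ^ (k + i)) * L)"
    by (simp add: c_def x_def algebra_simps power_one_over)
  also have "\<dots> \<le> m * card (good k i)"
    using Suc m0 unfolding L_def by (intro mult_left_mono)
  finally show ?case
    by (simp add: card_good_Suc m_def del: good.simps)
qed simp

subsection \<open>Box dimension\<close>

text \<open>The resolution at which \<open>len j\<close> arcs suffice. The growing exponent is what
  forces dimension 0.\<close>

definition scale :: "nat \<Rightarrow> real" where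
  "scale j = 1 / len (Suc j) ^ Suc j"

lemma scale_pos: "scale j > 0"
  by (simp add: scale_def)

lemma scale_antimono: "i \<le> j \<Longrightarrow> scale j \<le> scale i"
proof -
  assume "i \<le> j"
  then have "len (Suc i) ^ Suc i \<le> len (Suc j) ^ Suc i"
    by (intro power_mono len_mono) auto
  also have "\<dots> \<le> len (Suc j) ^ Suc j"
    using \<open>i \<le> j\<close> by (intro power_increasing) (auto simp: Suc_leI)
  finally have "real (len (Suc i) ^ Suc i) \<le> real (len (Suc j) ^ Suc j)"
    by (rule of_nat_mono)
  then show ?thesis
    unfolding scale_def by (intro divide_left_mono) auto
qed

lemma scale_le: "scale j \<le> (1 / 2) ^ j"
proof -
  have "2 ^ j \<le> len j ^ 1"
    using len_ge_power2 by simp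
  also have "\<dots> \<le> len (Suc j) ^ 1"
    using len_ge by simp
  also have "\<dots> \<le> len (Suc j) ^ Suc j"
    by (intro power_increasing) (auto simp: Suc_leI)
  finally have "real (2 ^ j) \<le> real (len (Suc j) ^ Suc j)"
    by (rule of_nat_mono)
  then show ?thesis
    unfolding scale_def power_one_over by (intro divide_left_mono) auto
qed

text \<open>Of the \<open>j + 3\<close> factors \<open>len (Suc j)\<close> in the denominator of
  \<open>step (Suc j)\<close>, one pays for the length of all copies of \<open>C\<^sub>j\<close> and
  \<open>j + 1\<close> form \<open>scale j\<close>.\<close>

lemma total_drift_le: "reps (Suc j) * (2 * len j * step (Suc j)) \<le> scale j / 2 ^ (j + 4)"
proof -
  have "reps (Suc j) * (2 * len j * step (Suc j)) = real (reps (Suc j) * len j) * (2 * step (Suc j))"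
    by simp
  also have "\<dots> \<le> len (Suc j) * (2 * step (Suc j))"
    using reps_len_le[of j] step_nonneg by (intro mult_right_mono of_nat_mono) auto
  also have "\<dots> = 1 / (2 ^ (j + 4) * (den (Suc j) * len (Suc j)) * len (Suc j) ^ Suc j)"
    by (simp add: step_eq power_add eval_nat_numeral)
  also have "\<dots> \<le> 1 / (2 ^ (j + 4) * 1 * len (Suc j) ^ Suc j)"
  proof -
    have "1 \<le> real (den (Suc j) * len (Suc j))"
      by (metis den_pos len_pos nat_0_less_mult_iff of_nat_1 of_nat_mono Suc_leI One_nat_def)
    then show ?thesis
      by (intro divide_left_mono mult_right_mono mult_left_mono) auto
  qed
  finally show ?thesis
    by (simp add: scale_def mult.commute)
qed

text \<open>Reducing \<open>n\<close> modulo \<open>len (j + d)\<close> level by level ends below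
  \<open>len j\<close>, and only whole blocks are dropped. The reduction at level
  \<open>j + s\<close> costs at most \<open>scale j / 2 ^ (s + 2)\<close> modulo integers; the bound
  is the sum of these costs over \<open>s < d\<close>.\<close>

lemma good_near_finite:
  assumes "k \<le> j" "n \<in> good k (j - k + d)"
  shows "\<exists>r<len j. \<exists>z\<in>\<int>. \<bar>position n - position r - z\<bar> \<le> scale j * (1 / 2 - 1 / 2 ^ Suc d)"
  using assms(2)
proof (induction d arbitrary: n)
  case 0
  then show ?case
    using good_subset[of k "j - k"] assms(1) by (intro exI[of _ n] conjI bexI[of _ 0]) auto
next
  case (Suc d)
  have jd: "k + (j - k + d) = j + d"
    using assms(1) by simp
  define a where "a = n div len (j + d)"
  have n: "n < reps (Suc (j + d)) * len (j + d)" "n mod len (j + d) \<in> good k (j - k + d)"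
    using Suc.prems by (auto simp: jd)
  have a: "a \<le> reps (Suc (j + d))"
    using n(1) by (simp add: a_def less_mult_imp_div_less less_imp_le)
  obtain r z where r: "r < len j" "z \<in> \<int>"
      "\<bar>position (n mod len (j + d)) - position r - z\<bar> \<le> scale j * (1 / 2 - 1 / 2 ^ Suc d)"
    using Suc.IH[OF n(2)] by blast
  obtain y where y: "y \<in> \<int>"
      "\<bar>position (len (j + d)) - y\<bar> \<le> 2 * len (j + d) * step (Suc (j + d))"
    unfolding position_len by (rule block_drift)
  have "position n = a * position (len (j + d)) + position (n mod len (j + d))"
    using position_repeat[of "n mod len (j + d)" "j + d" a] n(1) by (simp add: a_def)
  then have "position n - position r - (a * y + z) =
      a * (position (len (j + d)) - y) + (position (n mod len (j + d)) - position r - z)"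
    by (simp add: algebra_simps)
  moreover have "\<bar>a * (position (len (j + d)) - y)\<bar> \<le> scale j / 2 ^ Suc (Suc d)"
  proof -
    have "\<bar>a * (position (len (j + d)) - y)\<bar> \<le>
        reps (Suc (j + d)) * (2 * len (j + d) * step (Suc (j + d)))"
      unfolding abs_mult using a y(2) by (intro mult_mono) auto
    also have "\<dots> \<le> scale (j + d) / 2 ^ (j + d + 4)"
      by (rule total_drift_le)
    also have "\<dots> \<le> scale j / 2 ^ Suc (Suc d)"
      using scale_pos[of j] by (intro frac_le scale_antimono power_increasing) auto
    finally show ?thesis .
  qed
  ultimately have "\<bar>position n - position r - (a * y + z)\<bar>
      \<le> scale j * (1 / 2 - 1 / 2 ^ Suc d) + scale j / 2 ^ Suc (Suc d)"
    using r(3) by linarith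
  also have "\<dots> = scale j * (1 / 2 - 1 / 2 ^ Suc (Suc d))"
    by (simp add: field_simps)
  finally show ?case
    using r(1,2) y(1) by (intro exI[of _ r] conjI bexI[of _ "a * y + z"]) auto
qed

definition good_orbit :: "nat \<Rightarrow> circle set" where
  "good_orbit k = (\<lambda>n. circle_of_real (position n)) ` (\<Union>i. good k i)"

lemma covering_number_good_orbit:
  assumes "k \<le> j" "scale j \<le> \<rho>"
  shows "covering_number (good_orbit k) \<rho> \<le> len j"
proof -
  define arc where "arc r = circle_of_real ` {position r - \<rho> / 2..position r - \<rho> / 2 + \<rho>}" for r
  define \<I> where "\<I> = arc ` {..<len j}"
  have arc: "is_interval_of_length \<rho> (arc r)" for r
    unfolding is_interval_of_length_def arc_def by blast
  have "good_orbit k \<subseteq> \<Union>\<I>"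
    unfolding good_orbit_def
  proof clarify
    fix n i assume "n \<in> good k i"
    \<comment> \<open>Raising the level to at least \<open>j\<close> brings \<open>n\<close> into
      the form that the approximation requires.\<close>
    then have "n \<in> good k (j - k + i)"
      using good_mono[of i "j - k + i" k] by auto
    then obtain r z where r: "r < len j" "z \<in> \<int>"
        "\<bar>position n - position r - z\<bar> \<le> scale j * (1 / 2 - 1 / 2 ^ Suc i)"
      using good_near_finite[OF assms(1)] by blast
    have "scale j * (1 / 2 - 1 / 2 ^ Suc i) \<le> scale j * (1 / 2)"
      using scale_pos[of j] by (intro mult_left_mono) auto
    then have "position n - z \<in> {position r - \<rho> / 2..position r - \<rho> / 2 + \<rho>}"
      using r(3) assms(2) by auto
    moreover have "circle_of_real (position n) = circle_of_real (position n - z)"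
      using r(2) by (simp add: circle_of_real_eq_iff)
    ultimately show "circle_of_real (position n) \<in> \<Union>\<I>"
      using r(1) unfolding \<I>_def arc_def by blast
  qed
  then have "covering_number (good_orbit k) \<rho> \<le> card \<I>"
    unfolding covering_number_def
    by (intro Least_le exI[of _ \<I>]) (auto simp: \<I>_def arc)
  also have "\<dots> \<le> len j"
    unfolding \<I>_def using card_image_le[of "{..<len j}" arc] by simp
  finally show ?thesis .
qed

lemma box_dim_good_orbit: "has_box_dim (good_orbit k) 0"
  unfolding has_box_dim_def
proof (rule tendstoI)
  fix e :: real assume "e > 0"
  then obtain i where i: "1 / real (Suc i) < e"
    using nat_approx_posE by blast
  define j0 where "j0 = max k (Suc i)"
  have "\<forall>\<^sub>F \<rho> in at_right 0. \<rho> \<in> {0<..<scale j0}"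
    using scale_pos by (rule eventually_at_right_real)
  then show "\<forall>\<^sub>F \<rho> in at_right 0.
      dist (ln (real (covering_number (good_orbit k) \<rho>)) / ln (1 / \<rho>)) 0 < e"
  proof eventually_elim
    fix \<rho> assume \<rho>: "\<rho> \<in> {0<..<scale j0}"
    obtain l where "(1 / 2) ^ l < \<rho>"
      using real_arch_pow_inv[of \<rho> "1 / 2"] \<rho> by auto
    then have ex: "scale l \<le> \<rho>"
      using scale_le[of l] by simp
    \<comment> \<open>Minimality gives \<open>\<rho> < scale (j - 1)\<close>, that is
      \<open>len j ^ j < 1 / \<rho>\<close>, while \<open>len j\<close> arcs still cover; so the
      quotient is at most \<open>1 / j\<close>.\<close>
    define j where "j = (LEAST j. scale j \<le> \<rho>)"
    have j: "scale j \<le> \<rho>"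
      unfolding j_def using ex by (rule LeastI)
    have "j0 < j"
      using j \<rho> scale_antimono[of j j0] by force
    then obtain j' where j': "j = Suc j'"
      by (cases j) auto
    have "\<rho> < scale j'"
      using not_less_Least[of j' "\<lambda>j. scale j \<le> \<rho>"] j' by (simp add: j_def)
    then have "real (len j) ^ j < 1 / \<rho>"
      using \<rho> by (simp add: scale_def j' field_simps)
    then have "ln (real (len j) ^ j) < ln (1 / \<rho>)"
      by (intro ln_less_cancel_iff[THEN iffD2]) (use \<rho> in auto)
    then have ln_ge: "j * ln (len j) < ln (1 / \<rho>)"
      by (simp add: ln_realpow)
    have "1 < real (len j)"
      using less_len[of j] \<open>j0 < j\<close> by simp
    then have pos: "0 < ln (real (len j))"
      by simp
    define N where "N = covering_number (good_orbit k) \<rho>"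
    \<comment> \<open>The case \<open>N = 0\<close> is settled by the convention
      \<open>ln 0 = 0\<close>.\<close>
    have N: "0 \<le> ln (real N)" "ln (real N) \<le> ln (real (len j))"
      using covering_number_good_orbit[of k j \<rho>] j \<open>j0 < j\<close> pos
      by (cases "N = 0"; simp add: N_def j0_def)+
    have "0 < ln (1 / \<rho>)"
      using ln_ge pos by (smt (verit) mult_nonneg_nonneg of_nat_0_le_iff)
    have "ln (real N) / ln (1 / \<rho>) \<le> ln (real (len j)) / (j * ln (len j))"
      using N ln_ge pos \<open>j0 < j\<close> by (intro frac_le) auto
    also have "\<dots> = 1 / j"
      using pos by simp
    also have "\<dots> \<le> 1 / real (Suc i)"
      using \<open>j0 < j\<close> by (intro divide_left_mono) (auto simp: j0_def)
    finally show "dist (ln (real (covering_number (good_orbit k) \<rho>)) / ln (1 / \<rho>)) 0 < e"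
      using i N(1) \<open>0 < ln (1 / \<rho>)\<close> by (simp add: N_def)
  qed
qed

section \<open>Lower density of the removed indices\<close>

definition exceptional :: "nat \<Rightarrow> nat set" where
  "exceptional k = {1..} - Suc ` (\<Union>i. good k i)"

text \<open>A lower limit is bounded by the values along a subsequence; here the block lengths
  \<open>len (k + i)\<close> are used.\<close>

lemma lower_density_exceptional: "lower_density (exceptional k) \<le> ereal (1 / 2 ^ k)"
proof (rule ccontr)
  assume "\<not> ?thesis"
  then have "\<forall>\<^sub>F N in sequentially.
      ereal (1 / 2 ^ k) < ereal (real (card (exceptional k \<inter> {1..N})) / real N)"
    unfolding lower_density_def by (intro less_LiminfD) simp
  then obtain i where i: "\<And>N. N \<ge> i \<Longrightarrow>
      1 / 2 ^ k < real (card (exceptional k \<inter> {1..N})) / real N"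
    unfolding eventually_sequentially by auto
  \<comment> \<open>The threshold \<open>i\<close> doubles as the level:
    \<open>len (k + i) > k + i\<close> places \<open>L\<close> beyond the threshold.\<close>
  define L where "L = len (k + i)"
  have "exceptional k \<inter> {1..L} \<subseteq> {1..L} - Suc ` good k i"
    by (auto simp: exceptional_def)
  then have "card (exceptional k \<inter> {1..L}) \<le> card ({1..L} - Suc ` good k i)"
    by (intro card_mono) auto
  also have "\<dots> = L - card (good k i)"
    using good_subset[of k i]
    by (subst card_Diff_subset) (auto simp: L_def card_image intro: finite_subset)
  finally have "real (card (exceptional k \<inter> {1..L})) \<le> L - real (card (good k i))"
    using card_mono[OF _ good_subset[of k i]] by (simp add: L_def)
  also have "\<dots> \<le> L - (1 - 1 / 2 ^ k + 1 / 2 ^ (k + i)) * L"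
    using card_good[of k i] by (simp add: L_def)
  also have "\<dots> \<le> 1 / 2 ^ k * L"
    by (simp add: algebra_simps)
  finally have "real (card (exceptional k \<inter> {1..L})) / L \<le> 1 / 2 ^ k"
    by (simp add: L_def field_simps)
  then show False
    using i[of L] less_len[of "k + i"] by (simp add: L_def)
qed

theorem theorem1p4:
  shows "\<exists>\<alpha> \<beta> :: real. rat_lin_indep_with_1 \<alpha> \<beta> \<and>
    (\<exists>t :: nat \<Rightarrow> circle. alpha_beta_orbit \<alpha> \<beta> t \<and>
      (\<forall>\<epsilon>::real. \<epsilon> > 0 \<longrightarrow>
        (\<exists>J \<subseteq> {1..}. lower_density J < ereal \<epsilon> \<and> has_box_dim (t ` ({1..} - J)) 0)))"
proof (rule exI[of _ alpha], rule exI[of _ beta], intro conjI rat_lin_indep_alpha_beta)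
  \<comment> \<open>Positions count from 0 and orbit indices from 1; the \<open>Suc\<close> in
    \<open>exceptional\<close> matches this shift.\<close>
  define t where "t n = circle_of_real (position (n - 1))" for n
  have "t (n + 1) - t n \<in> {circle_of_real alpha, circle_of_real beta}" if "n \<ge> 1" for n
    using that by (cases n) (auto simp: t_def circle_of_real_diff position_def)
  moreover have "\<exists>J \<subseteq> {1..}. lower_density J < ereal \<epsilon> \<and> has_box_dim (t ` ({1..} - J)) 0"
    if "\<epsilon> > 0" for \<epsilon> :: real
  proof -
    obtain k where k: "(1 / 2) ^ k < \<epsilon>"
      using real_arch_pow_inv[of \<epsilon> "1 / 2"] \<open>\<epsilon> > 0\<close> by auto
    have "{1..} - exceptional k = Suc ` (\<Union>i. good k i)"
      by (auto simp: exceptional_def)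
    then have "t ` ({1..} - exceptional k) = good_orbit k"
      by (simp add: image_image t_def good_orbit_def)
    moreover have "lower_density (exceptional k) < ereal \<epsilon>"
      using k by (intro le_less_trans[OF lower_density_exceptional]) (simp add: power_one_over)
    ultimately show ?thesis
      using box_dim_good_orbit[of k] by (intro exI[of _ "exceptional k"]) (auto simp: exceptional_def)
  qed
  ultimately show "\<exists>t :: nat \<Rightarrow> circle. alpha_beta_orbit alpha beta t \<and>
      (\<forall>\<epsilon>::real. \<epsilon> > 0 \<longrightarrow>
        (\<exists>J \<subseteq> {1..}. lower_density J < ereal \<epsilon> \<and> has_box_dim (t ` ({1..} - J)) 0))"
    unfolding alpha_beta_orbit_def by blast
qed

end
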